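(* Let $Y$ be a real random variable whose moment generating function $E[e^{tY}]$ exists for $|t|<r$, for some $r>0$. Then for any integer $n\ge 0$ and every real $x$, $$B_{n}^{(L,Y)}(x)=\sum_{k=0}^{n}k!\binom{x}{k} B_{n,k}\Big(B_{1}^{(L,Y)}(1),B_{2}^{(L,Y)}(1),\dots,B_{n-k+1}^{(L,Y)}(1)\Big),$$ where $\binom{x}{k}=\frac{x(x-1)\cdots(x-k+1)}{k!}$.
   Context: Partial Bell polynomials $B_{n,k}$ ($n\ge k\ge 0$) are defined by the formal power series identity $$\frac{1}{k!}\left(\sum_{j=1}^{\infty}x_{j}\frac{t^{j}}{j!}\right)^{k}=\sum_{n=k}^{\infty}B_{n,k}(x_{1},x_{2},\dots,x_{n-k+1})\frac{t^{n}}{n!}.$$ The probabilistic Lah numbers $L_Y(n,k)$ ($n\ge k\ge 0$) associated with $Y$ are defined by the power series expansion about $t=0$ $$\frac{1}{k!}\left(E\left[\left(\frac{1}{1-t}\right)^{Y}\right]-1\right)^{k}=\sum_{n=k}^{\infty}L_{Y}(n,k)\frac{t^{n}}{n!},\quad k\ge 0.$$ The probabilistic Lah-Bell polynomials associated with $Y$ are $B_{n}^{(L,Y)}(x)=\sum_{k=0}^{n}L_{Y}(n,k)x^{k}$, $n\ge 0$. *)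

theory Defs
  imports "HOL-Probability.Probability"
begin

text \<open>
  The value of the partial Bell polynomial \<open>B\<^sub>n\<^sub>,\<^sub>k\<close> at a sequence \<open>x\<close>: the coefficient of
  \<open>t^n / n!\<close> in \<open>(1 / k!) (\<Sum>j\<ge>1. x j t^j / j!)^k\<close>.  The arguments form a whole
  sequence, of which only \<open>x 1, \<dots>, x (n - k + 1)\<close> matter (\<open>partial_bell_cong\<close>); in particular
  \<open>x 0\<close> is ignored.
\<close>

definition partial_bell :: "nat \<Rightarrow> nat \<Rightarrow> (nat \<Rightarrow> 'a::field_char_0) \<Rightarrow> 'a" where
  "partial_bell n k x =
     fact n * fps_nth (fps_const (1 / fact k) * Abs_fps (\<lambda>j. if j = 0 then 0 else x j / fact j) ^ k) n"

lemma fps_power_nth_cong: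
  fixes F G :: "'a::field_char_0 fps"
  assumes "fps_nth F 0 = 0" "fps_nth G 0 = 0"
    and "\<And>j. \<lbrakk>1 \<le> j; j + k \<le> n + 1\<rbrakk> \<Longrightarrow> fps_nth F j = fps_nth G j"
  shows "fps_nth (F ^ k) n = fps_nth (G ^ k) n"
  using assms(3)
proof (induction k arbitrary: n)
  case 0
  then show ?case by simp
next
  case (Suc k)
  have low: "fps_nth (F ^ k) i = 0" "fps_nth (G ^ k) i = 0" if "i < k" for i
    using that assms(1,2) by (simp_all add: startsby_zero_power_prefix)
  have "fps_nth F i * fps_nth (F ^ k) (n - i) = fps_nth G i * fps_nth (G ^ k) (n - i)"
    if i: "i \<le> n" for i
  proof (cases "i = 0 \<or> n - i < k")
    case True
    then show ?thesis using low assms(1,2) by auto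
  next
    case False
    have "fps_nth F i = fps_nth G i"
      by (rule Suc.prems) (use False i in auto)
    moreover have "fps_nth (F ^ k) (n - i) = fps_nth (G ^ k) (n - i)"
      by (rule Suc.IH, rule Suc.prems) (use False i in auto)
    ultimately show ?thesis by simp
  qed
  then show ?case by (simp add: fps_mult_nth)
qed

lemma partial_bell_cong:
  assumes "k \<le> n" "\<And>j. j \<in> {1..n - k + 1} \<Longrightarrow> x j = y j"
  shows "partial_bell n k x = partial_bell n k y"
proof -
  have "fps_nth (Abs_fps (\<lambda>j. if j = 0 then 0 else x j / fact j) ^ k) n =
        fps_nth (Abs_fps (\<lambda>j. if j = 0 then 0 else y j / fact j) ^ k) n"
    by (rule fps_power_nth_cong) (use assms in auto)
  then show ?thesis by (simp add: partial_bell_def)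
qed

definition mgf_exists_near_0 :: "'b measure \<Rightarrow> ('b \<Rightarrow> real) \<Rightarrow> bool" where
  "mgf_exists_near_0 M Y \<longleftrightarrow>
     (\<exists>r>0. \<forall>t. \<bar>t\<bar> < r \<longrightarrow> integrable M (\<lambda>\<omega>. exp (t * Y \<omega>)))"

text \<open>
  The expansion is the power series that converges to the function on a neighbourhood of
  \<open>t = 0\<close>; it is unique if it exists (\<open>has_fps_expansion_unique_real\<close>).
\<close>

definition prob_lah :: "'b measure \<Rightarrow> ('b \<Rightarrow> real) \<Rightarrow> nat \<Rightarrow> nat \<Rightarrow> real" where
  "prob_lah M Y n k =
     fact n * fps_nth (THE F. (\<lambda>t. 1 / fact k *
       (integral\<^sup>L M (\<lambda>\<omega>. (1 / (1 - t)) powr Y \<omega>) - 1) ^ k) has_fps_expansion F) n"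

lemma has_fps_expansion_unique_real:
  fixes f :: "real \<Rightarrow> real"
  assumes "f has_fps_expansion F" "f has_fps_expansion G"
  shows "F = G"
proof (rule fps_ext)
  have radius: "fps_conv_radius F > 0" "fps_conv_radius G > 0"
    and ev: "eventually (\<lambda>z. eval_fps F z = eval_fps G z) (nhds 0)"
    using assms by (auto simp: has_fps_expansion_def elim: eventually_elim2)
  fix n
  from radius ev show "fps_nth F n = fps_nth G n"
  proof (induction n arbitrary: F G)
    case 0
    then show ?case using eventually_nhds_x_imp_x by (fastforce simp: eval_fps_at_0)
  next
    case (Suc n F G)
    have in_ball: "eventually (\<lambda>z::real. z \<in> eball 0 (fps_conv_radius H)) (nhds 0)"
      if "fps_conv_radius H > 0" for H :: "real fps"
      using that by (intro eventually_nhds_in_open) (auto simp: zero_ereal_def)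
    have "eventually (\<lambda>z. eventually (\<lambda>w. eval_fps F w = eval_fps G w) (nhds z)) (nhds 0)"
      using Suc.prems(3) by (simp add: eventually_eventually)
    then have "eventually (\<lambda>z. eval_fps (fps_deriv F) z = eval_fps (fps_deriv G) z) (nhds 0)"
      using in_ball[OF Suc.prems(1)] in_ball[OF Suc.prems(2)]
    proof eventually_elim
      case (elim z)
      then show ?case by (simp add: eval_fps_deriv deriv_cong_ev)
    qed
    then have "fps_nth (fps_deriv F) n = fps_nth (fps_deriv G) n"
      using Suc.prems fps_conv_radius_deriv[of F] fps_conv_radius_deriv[of G]
      by (intro Suc.IH) auto
    then show ?case by (simp del: of_nat_Suc)
  qed
qed

definition prob_lah_bell :: "'b measure \<Rightarrow> ('b \<Rightarrow> real) \<Rightarrow> nat \<Rightarrow> real \<Rightarrow> real" where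
  "prob_lah_bell M Y n x = (\<Sum>k=0..n. prob_lah M Y n k * x ^ k)"

end

theory Submission
  imports Defs "HOL-Complex_Analysis.Laurent_Convergence"
begin

text \<open>
  Since \<open>\<bar>(Y)\<^sub>n\<bar> \<le> (\<bar>Y\<bar>)\<^sub>n\<close> for rising factorials, the binomial series of \<open>(1 - t)\<^sup>-\<^sup>Y\<close> is dominated
  by that of \<open>(1 - \<bar>t\<bar>)\<close> to the power \<open>- \<bar>Y\<bar>\<close>, which is integrable for small \<open>t\<close>. Integrating termwise,
  the expectation has an expansion \<open>G\<close> at \<open>0\<close>, and \<open>F = G - 1\<close> has no constant term.
  The exponential generating function of the probabilistic Lah-Bell polynomials is then \<open>exp (x F)\<close>,
  and the theorem is the coefficientwise form of \<open>exp (x F) = (1 + (exp F - 1))\<^sup>x\<close>, with the right-hand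
  side expanded as a binomial series.
\<close>

lemma abs_pochhammer_le:
  fixes y :: real
  shows "\<bar>pochhammer y n\<bar> \<le> pochhammer \<bar>y\<bar> n"
  unfolding pochhammer_prod abs_prod by (intro prod_mono) auto

text \<open>The generalized binomial series at \<open>- t\<close> with exponent \<open>- y\<close>;
  the signs of the two negations cancel and leave rising factorials.\<close>

lemma pochhammer_sums_powr:
  fixes t y :: real
  assumes "\<bar>t\<bar> < 1"
  shows "(\<lambda>n. pochhammer y n / fact n * t ^ n) sums (1 / (1 - t)) powr y"
proof -
  have "((- y) gchoose n) * (- t) ^ n = pochhammer y n / fact n * t ^ n" for n
    by (simp add: gbinomial_pochhammer power_minus[of t])
  moreover have "(1 + (- t)) powr (- y) = (1 / (1 - t)) powr y"
    using assms by (simp add: powr_minus_divide powr_divide)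
  ultimately show ?thesis
    using gen_binomial_real[of "- t" "- y"] assms by simp
qed

text \<open>A bound on all partial sums of absolute values by one integrable \<open>w\<close> yields
  both pointwise absolute summability and summability of the L1 norms, which together permit
  termwise integration.\<close>

lemma integral_sums_dominated:
  fixes f :: "nat \<Rightarrow> 'b \<Rightarrow> real"
  assumes meas: "\<And>i. f i \<in> borel_measurable M"
    and w: "integrable M w"
    and bound: "\<And>n \<omega>. (\<Sum>i<n. \<bar>f i \<omega>\<bar>) \<le> w \<omega>"
  shows "(\<lambda>i. integral\<^sup>L M (f i)) sums (\<integral>\<omega>. (\<Sum>i. f i \<omega>) \<partial>M)"
proof (rule sums_integral)
  show int: "integrable M (f i)" for i
  proof (rule Bochner_Integration.integrable_bound[OF w meas])
    have "\<bar>f i \<omega>\<bar> \<le> (\<Sum>j<Suc i. \<bar>f j \<omega>\<bar>)" for \<omega>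
      by (simp add: sum_nonneg)
    then have "\<bar>f i \<omega>\<bar> \<le> \<bar>w \<omega>\<bar>" for \<omega>
      using bound[where n = "Suc i" and \<omega> = \<omega>] by (meson abs_ge_self order_trans)
    then show "AE \<omega> in M. norm (f i \<omega>) \<le> norm (w \<omega>)"
      by simp
  qed
  show "AE \<omega> in M. summable (\<lambda>i. norm (f i \<omega>))"
    using bound by (intro AE_I2 summableI_nonneg_bounded) auto
  show "summable (\<lambda>i. \<integral>\<omega>. norm (f i \<omega>) \<partial>M)"
  proof (rule summableI_nonneg_bounded)
    fix n
    have "(\<Sum>i<n. \<integral>\<omega>. norm (f i \<omega>) \<partial>M) = (\<integral>\<omega>. (\<Sum>i<n. norm (f i \<omega>)) \<partial>M)"
      using int by (subst Bochner_Integration.integral_sum) auto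
    also have "\<dots> \<le> integral\<^sup>L M w"
      using int w bound by (intro integral_mono) auto
    finally show "(\<Sum>i<n. \<integral>\<omega>. norm (f i \<omega>) \<partial>M) \<le> integral\<^sup>L M w" .
  qed simp
qed

lemma expectation_powr_has_fps_expansion:
  fixes Y :: "'b \<Rightarrow> real"
  assumes Y [measurable]: "Y \<in> borel_measurable M" and "mgf_exists_near_0 M Y"
  shows "(\<lambda>t. \<integral>\<omega>. (1 / (1 - t)) powr Y \<omega> \<partial>M) has_fps_expansion
    Abs_fps (\<lambda>n. (\<integral>\<omega>. pochhammer (Y \<omega>) n \<partial>M) / fact n)"
proof -
  obtain r where r: "r > 0" and mgf: "\<And>t. \<bar>t\<bar> < r \<Longrightarrow> integrable M (\<lambda>\<omega>. exp (t * Y \<omega>))"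
    using assms(2) unfolding mgf_exists_near_0_def by blast
  have "(\<lambda>n. (\<integral>\<omega>. pochhammer (Y \<omega>) n \<partial>M) / fact n * t ^ n) sums (\<integral>\<omega>. (1 / (1 - t)) powr Y \<omega> \<partial>M)"
    if t: "\<bar>t\<bar> < 1 - exp (- r)" for t
  proof -
    have t1: "\<bar>t\<bar> < 1"
      using t exp_gt_zero[of "- r"] by linarith
    \<comment> \<open>Chosen so that \<open>1 / (1 - \<bar>t\<bar>) = exp s\<close>; the radius
      \<open>1 - exp (- r)\<close> is exactly what forces \<open>s < r\<close>.\<close>
    define s where "s = - ln (1 - \<bar>t\<bar>)"
    have s0: "s \<ge> 0"
      using t1 by (simp add: s_def)
    have "ln (exp (- r)) < ln (1 - \<bar>t\<bar>)"
      using t t1 by (subst ln_less_cancel_iff) auto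
    then have "s < r"
      by (simp add: s_def)
    define f where "f = (\<lambda>n \<omega>. pochhammer (Y \<omega>) n / fact n * t ^ n)"
    \<comment> \<open>One of the two summands equals
      \<open>exp (s * \<bar>Y \<omega>\<bar>)\<close>, and both are values of the moment generating
      integrand at points within \<open>r\<close> of 0.\<close>
    define w where "w \<omega> = exp (s * Y \<omega>) + exp (- s * Y \<omega>)" for \<omega>
    have "integrable M w"
      unfolding w_def using mgf[of s] mgf[of "- s"] s0 \<open>s < r\<close> by (intro Bochner_Integration.integrable_add) auto
    moreover have "(\<Sum>i<n. \<bar>f i \<omega>\<bar>) \<le> w \<omega>" for n \<omega>
    proof -
      have "(\<Sum>i<n. \<bar>f i \<omega>\<bar>) \<le> (\<Sum>i<n. pochhammer \<bar>Y \<omega>\<bar> i / fact i * \<bar>t\<bar> ^ i)"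
        unfolding f_def
        by (intro sum_mono) (auto simp: abs_mult power_abs intro!: mult_right_mono divide_right_mono abs_pochhammer_le)
      also have "\<dots> \<le> (\<Sum>i. pochhammer \<bar>Y \<omega>\<bar> i / fact i * \<bar>t\<bar> ^ i)"
        using pochhammer_sums_powr[of "\<bar>t\<bar>" "\<bar>Y \<omega>\<bar>"] t1
        by (intro sum_le_suminf) (auto simp: sums_iff intro!: mult_nonneg_nonneg divide_nonneg_nonneg
            order_trans[OF abs_ge_zero abs_pochhammer_le])
      also have "\<dots> = (1 / (1 - \<bar>t\<bar>)) powr \<bar>Y \<omega>\<bar>"
        using pochhammer_sums_powr[of "\<bar>t\<bar>" "\<bar>Y \<omega>\<bar>"] t1 by (simp add: sums_iff)
      also have "\<dots> = exp (s * \<bar>Y \<omega>\<bar>)"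
        using t1 by (simp add: powr_def ln_div s_def mult.commute)
      also have "\<dots> \<le> w \<omega>"
        unfolding w_def by (cases "Y \<omega> \<ge> 0") auto
      finally show ?thesis .
    qed
    moreover have "f n \<in> borel_measurable M" for n
      unfolding f_def pochhammer_prod by measurable
    ultimately have "(\<lambda>n. integral\<^sup>L M (f n)) sums (\<integral>\<omega>. (\<Sum>n. f n \<omega>) \<partial>M)"
      by (intro integral_sums_dominated)
    moreover have "(\<Sum>n. f n \<omega>) = (1 / (1 - t)) powr Y \<omega>" for \<omega>
      using pochhammer_sums_powr[OF t1, of "Y \<omega>"] by (simp add: f_def sums_iff)
    ultimately show ?thesis
      by (simp add: f_def)
  qed
  moreover have "eventually (\<lambda>t. \<bar>t\<bar> < 1 - exp (- r)) (nhds (0::real))"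
    using r unfolding eventually_nhds_metric by (intro exI[of _ "1 - exp (- r)"]) auto
  ultimately show ?thesis
    by (intro has_fps_expansionI) (auto elim: eventually_mono)
qed

text \<open>From \<open>(1 + X) B' = c B\<close> for the binomial series and
  \<open>E' = 1 + E\<close> for \<open>E = exp - 1\<close>, the chain rule gives
  \<open>D' = c D\<close> for the composite; with constant term 1 this ODE characterizes
  \<open>fps_exp c\<close>.\<close>

lemma fps_binomial_compose_exp_minus_1:
  fixes c :: "'a::field_char_0"
  shows "fps_binomial c oo (fps_exp 1 - 1) = fps_exp c"
proof -
  let ?E = "fps_exp 1 - 1 :: 'a fps" and ?D = "fps_binomial c oo (fps_exp 1 - 1)"
  have E0: "fps_nth ?E 0 = 0"
    by simp
  have "fps_deriv (fps_binomial c) * (1 + fps_X) = fps_const c * fps_binomial c"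
    by (simp add: fps_binomial_deriv fps_divide_unit mult.assoc inverse_mult_eq_1)
  then have "(fps_deriv (fps_binomial c) oo ?E) * ((1 + fps_X) oo ?E) = fps_const c * ?D"
    using fps_compose_mult_distrib[OF E0] by (metis fps_const_compose)
  then have "fps_deriv ?D = fps_const c * ?D"
    by (simp add: fps_compose_deriv[OF E0] fps_compose_add_distrib)
  then show ?thesis
    using fps_exp_unique_ODE[of ?D c] by (simp add: fps_compose_nth)
qed

lemma fps_exp_compose_eq_binomial_compose:
  fixes F :: "'a::field_char_0 fps"
  assumes "fps_nth F 0 = 0"
  shows "fps_exp c oo F = fps_binomial c oo ((fps_exp 1 oo F) - 1)"
proof -
  have "fps_exp c oo F = (fps_binomial c oo (fps_exp 1 - 1)) oo F"
    by (simp add: fps_binomial_compose_exp_minus_1)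
  also have "\<dots> = fps_binomial c oo ((fps_exp 1 - 1) oo F)"
    using assms by (intro fps_compose_assoc[symmetric]) auto
  finally show ?thesis
    by (simp add: fps_compose_sub_distrib)
qed

text \<open>Uniqueness of real expansions evaluates the definite description.\<close>

lemma prob_lah_eq_fps_nth:
  assumes "(\<lambda>t. \<integral>\<omega>. (1 / (1 - t)) powr Y \<omega> \<partial>M) has_fps_expansion G"
  shows "prob_lah M Y n k = fact n * (fps_nth ((G - 1) ^ k) n / fact k)"
proof -
  have "(\<lambda>t. 1 / fact k * ((\<integral>\<omega>. (1 / (1 - t)) powr Y \<omega> \<partial>M) - 1) ^ k)
      has_fps_expansion fps_const (1 / fact k) * (G - 1) ^ k"
    using assms by (intro fps_expansion_intros)
  then have "(THE F. (\<lambda>t. 1 / fact k * ((\<integral>\<omega>. (1 / (1 - t)) powr Y \<omega> \<partial>M) - 1) ^ k)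
      has_fps_expansion F) = fps_const (1 / fact k) * (G - 1) ^ k"
    by (blast intro: the_equality has_fps_expansion_unique_real)
  then show ?thesis
    by (simp add: prob_lah_def)
qed

text \<open>The factor \<open>x ^ k / fact k\<close> in the sum over \<open>k\<close> is the
  coefficient of \<open>fps_exp x\<close>.\<close>

lemma prob_lah_bell_eq_fps_nth:
  assumes "(\<lambda>t. \<integral>\<omega>. (1 / (1 - t)) powr Y \<omega> \<partial>M) has_fps_expansion G"
  shows "prob_lah_bell M Y n x = fact n * fps_nth (fps_exp x oo (G - 1)) n"
  by (simp add: prob_lah_bell_def prob_lah_eq_fps_nth[OF assms] fps_compose_nth sum_distrib_left
      mult_ac)

text \<open>The factor \<open>fact k\<close> cancels the \<open>1 / fact k\<close> inside
  \<open>partial_bell\<close>, leaving a binomial series in \<open>H\<close>. The second assumption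
  spares index 0 because the intended sequence has \<open>a 0 = 1\<close>, whereas \<open>H\<close>
  has constant term 0.\<close>

lemma sum_gchoose_partial_bell:
  fixes H :: "'a::field_char_0 fps"
  assumes "fps_nth H 0 = 0" "\<And>j. j > 0 \<Longrightarrow> a j = fact j * fps_nth H j"
  shows "(\<Sum>k=0..n. fact k * (x gchoose k) * partial_bell n k a) =
    fact n * fps_nth (fps_binomial x oo H) n"
proof -
  have "Abs_fps (\<lambda>j. if j = 0 then 0 else a j / fact j) = H"
    using assms by (auto simp: fps_eq_iff)
  then show ?thesis
    by (simp add: partial_bell_def fps_compose_nth sum_distrib_left mult_ac)
qed

theorem theorem2p8:
  fixes M :: "'b measure" and Y :: "'b \<Rightarrow> real" and n :: nat and x :: real
  assumes "prob_space M"
    and "Y \<in> borel_measurable M"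
    and "mgf_exists_near_0 M Y"
  shows "prob_lah_bell M Y n x =
    (\<Sum>k=0..n. fact k * (x gchoose k) * partial_bell n k (\<lambda>j. prob_lah_bell M Y j 1))"
proof -
  interpret prob_space M by fact
  define G where "G = Abs_fps (\<lambda>n. (\<integral>\<omega>. pochhammer (Y \<omega>) n \<partial>M) / fact n)"
  have G: "(\<lambda>t. \<integral>\<omega>. (1 / (1 - t)) powr Y \<omega> \<partial>M) has_fps_expansion G"
    unfolding G_def using assms(2,3) by (rule expectation_powr_has_fps_expansion)
  \<comment> \<open>The constant term of \<open>G\<close> is the total mass, which is 1.\<close>
  have "fps_nth (G - 1) 0 = 0"
    by (simp add: G_def prob_space)
  then have "fps_exp x oo (G - 1) = fps_binomial x oo ((fps_exp 1 oo (G - 1)) - 1)"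
    by (rule fps_exp_compose_eq_binomial_compose)
  moreover have "(\<Sum>k=0..n. fact k * (x gchoose k) * partial_bell n k (\<lambda>j. prob_lah_bell M Y j 1)) =
      fact n * fps_nth (fps_binomial x oo ((fps_exp 1 oo (G - 1)) - 1)) n"
    by (rule sum_gchoose_partial_bell) (simp_all add: prob_lah_bell_eq_fps_nth[OF G])
  ultimately show ?thesis
    by (simp add: prob_lah_bell_eq_fps_nth[OF G])
qed

end
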